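(* For $n\ge N\ge2$ we have $$A(n,N)+A(n,N+1)=A(n+1,N+1).$$ Moreover, $$\sum_{k=N}^nA(k,N)=A(n+1,N+1),\qquad N\ge2.$$
   Context: For $m\ge2$, $p_1(m)$ is the smallest prime divisor of $m$. For $2\le N\le n$, $A(n,N)$ (a Cyrillic "el" in the paper) is the number of compositions $(\lambda_1,\dots,\lambda_N)\in\mathbb Z_{>0}^N$ with $\lambda_1+\dots+\lambda_N=n$ and $\min\{\lambda_1,\lambda_2\}<p_1(\lambda_1+\lambda_2)$; it is the number of partial flag varieties $F_{\boldsymbol\lambda}$ of $N$-step flags in $\mathbb C^n$ whose first semiclassical spectrum is not exceeding (one gets the same number using $(\lambda_i,\lambda_{i+1})$ for any fixed $i\le N-1$). We set $A(n,N)=0$ if $n<N$. In the second identity, $n\ge N$. *)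

theory Defs
  imports "HOL-Computational_Algebra.Primes"
begin

(* Meaningful for m \<ge> 2 only. *)
definition smallest_prime_divisor :: "nat \<Rightarrow> nat" where
  "smallest_prime_divisor m = (LEAST p. prime p \<and> p dvd m)"

definition compositions :: "nat \<Rightarrow> nat \<Rightarrow> nat list set" where
  "compositions n N = {xs. length xs = N \<and> (\<forall>x\<in>set xs. 0 < x) \<and> sum_list xs = n}"

(* Number of N-step partial flag varieties of C^n, indexed by compositions of n into N
   parts, whose first semiclassical spectrum is not exceeding. List positions start at 0,
   so xs ! 0 and xs ! 1 are lambda_1 and lambda_2. Meaningful for N \<ge> 2 only. *)
definition non_exceeding_count :: "nat \<Rightarrow> nat \<Rightarrow> nat" where
  "non_exceeding_count n N =
     (if n < N then 0
      else card {xs \<in> compositions n N.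
             min (xs ! 0) (xs ! 1) < smallest_prime_divisor (xs ! 0 + xs ! 1)})"

end

theory Submission
  imports Defs
begin

text \<open>
  For \<open>N \<ge> 2\<close> the condition on a composition with \<open>N + 1\<close> parts concerns only its first two
  parts, so it survives deletion of the last part. Deletion sorts the admissible compositions of
  \<open>n + 1\<close> with \<open>N + 1\<close> parts by the sum \<open>k\<close> of the remaining \<open>N\<close> parts. Here \<open>k \<le> n\<close> because
  the last part is positive, and \<open>k \<ge> N\<close> because the others are. The last part is determined as
  \<open>n + 1 - k\<close>, so the class of \<open>k\<close> has as many elements as there are admissible compositions of
  \<open>k\<close> with \<open>N\<close> parts. This is the summation formula, and splitting off its term \<open>k = n\<close> yields
  the Pascal-type recursion.
\<close>

definition non_exceeding_compositions :: "nat \<Rightarrow> nat \<Rightarrow> nat list set" where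
  "non_exceeding_compositions n N =
     {xs \<in> compositions n N. min (xs ! 0) (xs ! 1) < smallest_prime_divisor (xs ! 0 + xs ! 1)}"

lemma length_le_sum_list_pos:
  fixes xs :: "nat list"
  assumes "\<forall>x\<in>set xs. 0 < x"
  shows "length xs \<le> sum_list xs"
  using assms by (induction xs) auto

lemma compositions_eq_empty:
  assumes "n < N"
  shows "compositions n N = {}"
  using assms length_le_sum_list_pos by (fastforce simp: compositions_def)

lemma finite_compositions: "finite (compositions n N)"
proof (rule finite_subset)
  show "compositions n N \<subseteq> {xs. set xs \<subseteq> {..n} \<and> length xs = N}"
    using member_le_sum_list by (fastforce simp: compositions_def)
  show "finite {xs. set xs \<subseteq> {..n} \<and> length xs = N}"
    by (simp add: finite_lists_length_eq)
qed

lemma finite_non_exceeding_compositions: "finite (non_exceeding_compositions n N)"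
  by (simp add: non_exceeding_compositions_def finite_compositions)

lemma non_exceeding_count_eq_card:
  "non_exceeding_count n N = card (non_exceeding_compositions n N)"
  by (simp add: non_exceeding_count_def non_exceeding_compositions_def compositions_eq_empty)

lemma append_mem_non_exceeding_compositions_iff:
  assumes "2 \<le> N"
  shows "ys @ [y] \<in> non_exceeding_compositions n (N + 1) \<longleftrightarrow>
           0 < y \<and> y \<le> n \<and> ys \<in> non_exceeding_compositions (n - y) N"
  using assms
  by (auto simp: non_exceeding_compositions_def compositions_def nth_append)

text \<open>The classes of the deletion map, which are indexed by the sum of the remaining parts.\<close>

lemma non_exceeding_compositions_Suc_eq_UN:
  assumes "2 \<le> N"
  shows "non_exceeding_compositions (n + 1) (N + 1) =
           (\<Union>k\<in>{N..n}. (\<lambda>ys. ys @ [n + 1 - k]) ` non_exceeding_compositions k N)"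
    (is "?L = ?R")
proof (intro equalityI subsetI)
  fix xs assume xs: "xs \<in> ?L"
  then have "xs \<noteq> []"
    by (auto simp: non_exceeding_compositions_def compositions_def)
  then obtain ys y where split: "xs = ys @ [y]"
    by (metis append_butlast_last_id)
  have y: "0 < y" "y \<le> n + 1" and ys: "ys \<in> non_exceeding_compositions (n + 1 - y) N"
    using xs append_mem_non_exceeding_compositions_iff[OF assms] unfolding split by blast+
  have "N \<le> n + 1 - y"
    using ys compositions_eq_empty[of "n + 1 - y" N]
    by (fastforce simp: non_exceeding_compositions_def)
  moreover have "xs = ys @ [n + 1 - (n + 1 - y)]"
    using split y by simp
  ultimately show "xs \<in> ?R"
    using ys y by (intro UN_I[of "n + 1 - y"]) auto
next
  fix xs assume "xs \<in> ?R"
  then obtain k ys where "k \<le> n" "ys \<in> non_exceeding_compositions k N" "xs = ys @ [n + 1 - k]"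
    by auto
  then show "xs \<in> ?L"
    using append_mem_non_exceeding_compositions_iff[OF assms] by simp
qed

lemma sum_non_exceeding_count:
  assumes "2 \<le> N"
  shows "(\<Sum>k = N..n. non_exceeding_count k N) = non_exceeding_count (n + 1) (N + 1)"
proof -
  let ?A = "\<lambda>k. (\<lambda>ys. ys @ [n + 1 - k]) ` non_exceeding_compositions k N"
  have "card (\<Union>k\<in>{N..n}. ?A k) = (\<Sum>k = N..n. card (?A k))"
    by (rule card_UN_disjoint) (auto simp: finite_non_exceeding_compositions)
  also have "\<dots> = (\<Sum>k = N..n. non_exceeding_count k N)"
    by (intro sum.cong refl) (simp add: card_image inj_on_def non_exceeding_count_eq_card)
  finally show ?thesis
    by (simp add: non_exceeding_count_eq_card non_exceeding_compositions_Suc_eq_UN[OF assms, simplified])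
qed

theorem corollary4p4:
  fixes n N :: nat
  assumes "2 \<le> N" and "N \<le> n"
  shows "non_exceeding_count n N + non_exceeding_count n (N + 1)
           = non_exceeding_count (n + 1) (N + 1)
         \<and> (\<Sum>k = N..n. non_exceeding_count k N) = non_exceeding_count (n + 1) (N + 1)"
proof
  obtain m where n: "n = m + 1"
    using assms by (cases n) auto
  \<comment> \<open>For \<open>N = n\<close> the sum up to \<open>m\<close> is empty, in accordance with \<open>non_exceeding_count n (N + 1) = 0\<close>.\<close>
  have "non_exceeding_count (n + 1) (N + 1) = (\<Sum>k = N..m + 1. non_exceeding_count k N)"
    using sum_non_exceeding_count[OF assms(1), of n] n by simp
  also have "\<dots> = (\<Sum>k = N..m. non_exceeding_count k N) + non_exceeding_count n N"
    using assms(2) n by simp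
  also have "(\<Sum>k = N..m. non_exceeding_count k N) = non_exceeding_count n (N + 1)"
    using sum_non_exceeding_count[OF assms(1), of m] n by simp
  finally show "non_exceeding_count n N + non_exceeding_count n (N + 1)
                  = non_exceeding_count (n + 1) (N + 1)"
    by simp
  show "(\<Sum>k = N..n. non_exceeding_count k N) = non_exceeding_count (n + 1) (N + 1)"
    by (rule sum_non_exceeding_count[OF assms(1)])
qed

end
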